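(* Let $(Y,\mathcal{T}')$ be a $c$-Lusin space obtained by means of a continuous bijection $f:(X,\mathcal{T})\to (Y,\mathcal{T}')$, where $(X,\mathcal{T})$ is a noncompact, locally compact Polish space and $(Y,\mathcal{T}')$ is Hausdorff. Then there exists an open subset $Z\subset Y$ such that, with $Y_1 := Y\setminus Z$, $\mathcal{T}'_Z=\{A\cap Z: A\in\mathcal{T}'\}$ and $\mathcal{T}'_1=\{A\cap Y_1: A\in\mathcal{T}'\}$, the following hold: (a) $(Z,\mathcal{T}'_Z)$ is a locally compact Polish space; (b) $(Y_1,\mathcal{T}'_1)$ is a $c$-Lusin space. Moreover, $Y_1$ is a nowhere dense subset of $Y$ if and only if $(Y,\mathcal{T}')$ is a Baire space. If $f$ is feebly open (hence $Y$ is a Baire space), then $X_1:=f^{-1}(Y_1)$ is nowhere dense in $X$.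
   Context: A Polish space is a separable topological space whose topology is consistent with a complete metric. A $c$-Lusin space is a Hausdorff space that is the image of a noncompact and locally compact Polish space under a continuous bijection. A set is nowhere dense if its closure has empty interior. A topological space is a Baire space if the union of any countable collection of its closed subsets, each with empty interior, also has empty interior. A map $f:(X,\mathcal{T})\to(Y,\mathcal{T}')$ is feebly open if for each nonempty $A\in\mathcal{T}$ there exists a nonempty $B\in\mathcal{T}'$ such that $B\subset f(A)$.
   Formalization: Part (b) is false as stated (e.g. X = Y = discrete N); the formal version allows, instead of Y_1 being c-Lusin, that Y_1 is finite, but only when Y has finitely many accumulation points, where the English claim always fails. *)

theory Defs
  imports "HOL-Analysis.Analysis"
begin

definition Polish_space :: "'a topology \<Rightarrow> bool" where
  "Polish_space X \<longleftrightarrow> separable_space X \<and> completely_metrizable_space X"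

(* The domain X is a topology over the same type as Y. This loses nothing: along a bijection
   any domain can be transported to the carrier of Y; see c_Lusin_spaceI below, where the
   domain has an arbitrary type. *)
definition c_Lusin_space :: "'b topology \<Rightarrow> bool" where
  "c_Lusin_space Y \<longleftrightarrow> Hausdorff_space Y \<and>
     (\<exists>(X::'b topology) f. \<not> compact_space X \<and> locally_compact_space X \<and> Polish_space X \<and>
        continuous_map X Y f \<and> bij_betw f (topspace X) (topspace Y))"

definition nowhere_dense_in :: "'a topology \<Rightarrow> 'a set \<Rightarrow> bool" where
  "nowhere_dense_in X S \<longleftrightarrow> S \<subseteq> topspace X \<and> X interior_of (X closure_of S) = {}"

definition Baire_space :: "'a topology \<Rightarrow> bool" where
  "Baire_space X \<longleftrightarrow>
     (\<forall>\<C>. countable \<C> \<and> (\<forall>C\<in>\<C>. closedin X C \<and> X interior_of C = {})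
        \<longrightarrow> X interior_of (\<Union>\<C>) = {})"

definition feebly_open_map :: "'a topology \<Rightarrow> 'b topology \<Rightarrow> ('a \<Rightarrow> 'b) \<Rightarrow> bool" where
  "feebly_open_map X Y f \<longleftrightarrow>
     (\<forall>A. openin X A \<and> A \<noteq> {} \<longrightarrow> (\<exists>B. openin Y B \<and> B \<noteq> {} \<and> B \<subseteq> f ` A))"

lemma c_Lusin_spaceI:
  fixes X :: "'a topology" and Y :: "'b topology" and f :: "'a \<Rightarrow> 'b"
  assumes "Hausdorff_space Y" "\<not> compact_space X" "locally_compact_space X" "Polish_space X"
    and f: "continuous_map X Y f" "bij_betw f (topspace X) (topspace Y)"
  shows "c_Lusin_space Y"
proof -
  define g where "g = inv_into (topspace X) f"
  define T where "T = pullback_topology (topspace Y) g X"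
  have gf: "g (f x) = x" if "x \<in> topspace X" for x
    using that f(2) by (simp add: g_def bij_betw_def)
  have fg: "f (g y) = y" if "y \<in> topspace Y" for y
    using that f(2) by (simp add: g_def bij_betw_inv_into_right)
  have gin: "g y \<in> topspace X" if "y \<in> topspace Y" for y
    using that f(2) by (metis bij_betw_def g_def inv_into_into)
  have fin: "f x \<in> topspace Y" if "x \<in> topspace X" for x
    using that f(2) by (auto simp: bij_betw_def)
  have topT: "topspace T = topspace Y"
    using gin by (auto simp: T_def topspace_pullback_topology)
  have contg: "continuous_map T X g"
    unfolding continuous_map topT
    using gin by (auto simp: T_def openin_pullback_topology image_subset_iff)
  have contf: "continuous_map X T f"
  proof -
    have "openin X {x \<in> topspace X. f x \<in> U}" if U: "openin T U" for U
    proof -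
      obtain W where W: "openin X W" "U = g -` W \<inter> topspace Y"
        using U unfolding T_def openin_pullback_topology by blast
      have "{x \<in> topspace X. f x \<in> U} = W"
        using W openin_subset[OF W(1)] gf fin by auto
      then show ?thesis using W by simp
    qed
    then show ?thesis
      using fin by (auto simp: continuous_map topT image_subset_iff)
  qed
  have "homeomorphic_maps X T f g"
    using contf contg gf fg by (simp add: homeomorphic_maps_def topT)
  then have hom: "X homeomorphic_space T"
    by (auto simp: homeomorphic_space_def)
  have "continuous_map T Y (f \<circ> g)"
    using contg f(1) by (rule continuous_map_compose)
  moreover have "bij_betw (f \<circ> g) (topspace T) (topspace Y)"
    using fg by (simp add: topT bij_betw_def inj_on_def)
  moreover have "\<not> compact_space T"
    using assms(2) hom homeomorphic_compact_space by blast
  moreover have "locally_compact_space T"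
    using assms(3) hom homeomorphic_locally_compact_spaceD by blast
  moreover have "Polish_space T"
    using assms(4) hom homeomorphic_separable_space homeomorphic_completely_metrizable_space
    unfolding Polish_space_def by blast
  ultimately show ?thesis
    using assms(1) unfolding c_Lusin_space_def by blast
qed

lemma c_Lusin_space_imp_infinite:
  assumes "c_Lusin_space Y"
  shows "infinite (topspace Y)"
proof
  assume fin: "finite (topspace Y)"
  obtain X :: "'a topology" and f where "\<not> compact_space X" "bij_betw f (topspace X) (topspace Y)"
    using assms unfolding c_Lusin_space_def by blast
  then show False
    using fin bij_betw_finite[of f] finite_imp_compactin[of "topspace X" X] by (auto simp: compact_space_def)
qed

(* The discrete space of natural numbers is c-Lusin and Baire, its only nowhere dense subset is
   empty, and the empty space is not c-Lusin. So a Baire c-Lusin space need not split into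
   a locally compact Polish open set and a nowhere dense c-Lusin remainder. The failure is
   confined to spaces with only finitely many accumulation points: in a Hausdorff space a
   closed nowhere dense set consists of accumulation points, so there the remainder
   is forced to be finite. *)
lemma discrete_nat_no_c_Lusin_remainder:
  defines "Y \<equiv> discrete_topology (UNIV :: nat set)"
  shows "c_Lusin_space Y"
    and "Baire_space Y"
    and "\<not> (c_Lusin_space (subtopology Y S) \<and> nowhere_dense_in Y S)"
proof -
  have "\<not> compact_space Y" "locally_compact_space Y" "Hausdorff_space Y" "Polish_space Y"
    by (simp_all add: Y_def Polish_space_def compact_space_discrete_topology
        locally_compact_space_discrete_topology separable_space_discrete_topology
        completely_metrizable_space_discrete_topology)
  then show "c_Lusin_space Y"
    by (intro c_Lusin_spaceI[of Y Y id]) auto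
  show "Baire_space Y"
    by (fastforce simp: Baire_space_def Y_def interior_of_def)
  show "\<not> (c_Lusin_space (subtopology Y S) \<and> nowhere_dense_in Y S)"
  proof
    assume *: "c_Lusin_space (subtopology Y S) \<and> nowhere_dense_in Y S"
    then have "S = {}"
      by (auto simp: nowhere_dense_in_def Y_def interior_of_def discrete_topology_closure_of)
    then show False
      using * c_Lusin_space_imp_infinite[of "subtopology Y S"] by simp
  qed
qed

end

theory Submission
  imports Defs
begin

text \<open>The union \<open>Z\<^sub>0\<close> of the interiors in \<open>Y\<close> of the images \<open>f ` K\<close>, \<open>K\<close> compact in \<open>X\<close>, is open, and
  \<open>f\<close> is a homeomorphism over it, because the images of the compact sets \<open>K - A\<close> with \<open>A\<close> open are
  closed. Since \<open>X\<close> is \<open>\<sigma>\<close>-compact, the remainder \<open>Y - Z\<^sub>0\<close> is a countable union of closed sets, which have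
  empty interior by the choice of \<open>Z\<^sub>0\<close>; so \<open>Z\<^sub>0\<close> is dense as soon as \<open>Y\<close> is Baire.

  The remainder is a continuous bijective image of a closed subset of \<open>X\<close>, hence \<open>c\<close>-Lusin whenever it
  is infinite. To make it infinite if \<open>Y\<close> has infinitely many accumulation points, one removes from
  \<open>Z\<^sub>0\<close> the closure of an infinite discrete set of accumulation points of \<open>Y\<close>, which is nowhere dense.\<close>

section \<open>Polish spaces, and c-Lusin images of compact spaces\<close>

lemma separable_metrizable_imp_second_countable:
  assumes "separable_space X" "metrizable_space X"
  shows "second_countable X"
proof -
  obtain M d where "Metric_space M d" and X: "X = Metric_space.mtopology M d"
    using assms(2) unfolding metrizable_space_def by blast
  then interpret Metric_space M d by blast
  obtain C where C: "countable C" "C \<subseteq> M" "mtopology closure_of C = M"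
    using assms(1) unfolding separable_space_def X by auto
  let ?B = "(\<lambda>(c, n). mball c (inverse (Suc n))) ` (C \<times> (UNIV :: nat set))"
  have "\<exists>V\<in>?B. x \<in> V \<and> V \<subseteq> U" if U: "openin mtopology U" "x \<in> U" for U x
  proof -
    obtain r where r: "r > 0" "mball x r \<subseteq> U"
      using U openin_mtopology by blast
    \<comment> \<open>Half of \<open>r\<close>, since a ball about \<open>c\<close> that contains
      \<open>x\<close> reaches at most two of its radii away from \<open>x\<close>.\<close>
    obtain n where n: "inverse (Suc n) < r / 2"
      using r by (metis half_gt_zero reals_Archimedean)
    have x: "x \<in> M" using U openin_mtopology by blast
    then have "x \<in> mtopology closure_of C" by (simp add: C)
    moreover have "x \<in> mball x (inverse (Suc n))" using x by simp
    ultimately obtain c where c: "c \<in> C" "c \<in> mball x (inverse (Suc n))"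
      using openin_mball unfolding in_closure_of by blast
    have "mball c (inverse (Suc n)) \<subseteq> mball x r"
    proof
      fix y assume "y \<in> mball c (inverse (Suc n))"
      then show "y \<in> mball x r"
        using c n triangle[of x c y] by auto
    qed
    moreover have "x \<in> mball c (inverse (Suc n))"
      using c x by (simp add: commute)
    ultimately show ?thesis
      using c(1) r by blast
  qed
  moreover have "countable ?B" using C by simp
  ultimately show ?thesis
    unfolding second_countable_def X by (intro exI[of _ ?B]) auto
qed

lemma second_countable_prod_topology:
  assumes "second_countable X" "second_countable Y"
  shows "second_countable (prod_topology X Y)"
proof -
  obtain A where A: "countable A" "\<And>V. V \<in> A \<Longrightarrow> openin X V"
    "\<And>U x. openin X U \<Longrightarrow> x \<in> U \<Longrightarrow> \<exists>V\<in>A. x \<in> V \<and> V \<subseteq> U"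
    using assms(1) unfolding second_countable_def by metis
  obtain B where B: "countable B" "\<And>V. V \<in> B \<Longrightarrow> openin Y V"
    "\<And>U x. openin Y U \<Longrightarrow> x \<in> U \<Longrightarrow> \<exists>V\<in>B. x \<in> V \<and> V \<subseteq> U"
    using assms(2) unfolding second_countable_def by metis
  let ?C = "(\<lambda>(U, V). U \<times> V) ` (A \<times> B)"
  have "\<exists>W\<in>?C. z \<in> W \<and> W \<subseteq> S" if S: "openin (prod_topology X Y) S" "z \<in> S" for S z
  proof -
    obtain x y where z: "z = (x, y)" by force
    obtain U V where UV: "openin X U" "openin Y V" "x \<in> U" "y \<in> V" "U \<times> V \<subseteq> S"
      using S(1)[unfolded openin_prod_topology_alt, rule_format, of x y] S(2) z by auto
    obtain U' where U': "U' \<in> A" "x \<in> U'" "U' \<subseteq> U"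
      using A(3)[OF UV(1,3)] by blast
    obtain V' where V': "V' \<in> B" "y \<in> V'" "V' \<subseteq> V"
      using B(3)[OF UV(2,4)] by blast
    have "U' \<times> V' \<in> ?C" using U' V' by force
    moreover have "z \<in> U' \<times> V'" using z U' V' by simp
    moreover have "U' \<times> V' \<subseteq> S" using Sigma_mono[OF U'(3) V'(3)] UV(5) by simp
    ultimately show ?thesis by blast
  qed
  moreover have "countable ?C" using A(1) B(1) by simp
  ultimately show ?thesis
    unfolding second_countable_def using A(2) B(2)
    by (intro exI[of _ ?C]) (auto simp: openin_prod_Times_iff)
qed

text \<open>Separability need not pass to subspaces, whereas second countability does. For
  metrizable spaces the two agree, and in this form the Polish property is easily inherited by open
  and closed subspaces and by products.\<close>

lemma Polish_space_second_countable:
  "Polish_space X \<longleftrightarrow> second_countable X \<and> completely_metrizable_space X"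
proof -
  have "second_countable X" if "separable_space X" "completely_metrizable_space X"
    using that separable_metrizable_imp_second_countable completely_metrizable_imp_metrizable_space
    by blast
  then show ?thesis
    using second_countable_imp_separable_space[of X] unfolding Polish_space_def by blast
qed

lemma Polish_space_Hausdorff: "Polish_space X \<Longrightarrow> Hausdorff_space X"
  unfolding Polish_space_def
  using completely_metrizable_imp_metrizable_space metrizable_imp_Hausdorff_space by blast

lemma Polish_space_closedin:
  "Polish_space X \<Longrightarrow> closedin X S \<Longrightarrow> Polish_space (subtopology X S)"
  by (simp add: Polish_space_second_countable second_countable_subtopology
      completely_metrizable_space_closedin)

lemma Polish_space_openin:
  "Polish_space X \<Longrightarrow> openin X S \<Longrightarrow> Polish_space (subtopology X S)"
  by (simp add: Polish_space_second_countable second_countable_subtopology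
      completely_metrizable_space_openin)

lemma Polish_space_prod_topology:
  "Polish_space X \<Longrightarrow> Polish_space Y \<Longrightarrow> Polish_space (prod_topology X Y)"
  by (simp add: Polish_space_second_countable second_countable_prod_topology
      completely_metrizable_space_prod_topology)

lemma Polish_space_euclideanreal: "Polish_space euclideanreal"
proof -
  obtain B :: "real set set" where "countable B" "topological_basis B"
    using ex_countable_basis by blast
  then have "second_countable euclideanreal"
    unfolding second_countable_def open_openin[symmetric]
    by (metis topological_basisE topological_basis_open)
  then show ?thesis
    by (simp add: Polish_space_second_countable completely_metrizable_space_euclidean)
qed

text \<open>A limit point \<open>p\<close> of a compact domain can be split off as an isolated point without losing
  continuity or bijectivity. The resulting noncompact space is realized as the graph of
  \<open>x \<mapsto> 1 / d x p\<close> together with the point \<open>(p, 0)\<close>, which is closed in \<open>X \<times> \<real>\<close>.\<close>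

lemma c_Lusin_spaceI_infinite:
  fixes X :: "'a topology" and Y :: "'b topology"
  assumes Y: "Hausdorff_space Y" and inf: "infinite (topspace X)"
    and X: "locally_compact_space X" "Polish_space X"
    and f: "continuous_map X Y f" "bij_betw f (topspace X) (topspace Y)"
  shows "c_Lusin_space Y"
proof (cases "compact_space X")
  case False
  then show ?thesis using assms c_Lusin_spaceI by blast
next
  case True
  obtain M d where "Metric_space M d" and Xd: "X = Metric_space.mtopology M d"
    using X(2) unfolding Polish_space_def completely_metrizable_space_def by blast
  then interpret Metric_space M d by blast
  have top: "topspace X = M" by (simp add: Xd)
  obtain p where p: "p \<in> M" "p \<in> mtopology derived_set_of M"
    using True Bolzano_Weierstrass_A[of M M] inf unfolding compact_space_def Xd by auto
  define P where "P = prod_topology X euclideanreal"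
  \<comment> \<open>Multiplying out the quotient gives a condition that is continuous on all of
    \<open>P\<close>, hence a closed set. It has no solution over \<open>p\<close>, where the
    distance vanishes, so \<open>(p, 0)\<close> is the only point of \<open>G\<close> over
    \<open>p\<close>.\<close>
  define G where "G = {z \<in> topspace P. d (fst z) p * snd z \<in> {1}} \<union> {(p, 0)}"
  have topP: "topspace P = M \<times> UNIV" by (simp add: P_def top)
  have lc: "locally_compact_space P"
    unfolding P_def by (simp add: locally_compact_space_prod_topology X locally_compact_space_euclidean)
  have pol: "Polish_space P"
    unfolding P_def by (intro Polish_space_prod_topology X Polish_space_euclideanreal)
  have fst: "continuous_map P X fst" and snd: "continuous_map P euclideanreal snd"
    unfolding P_def by (simp_all add: continuous_map_fst continuous_map_snd)
  have "continuous_map P euclideanreal (\<lambda>z. d (fst z) p)"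
    using continuous_map_mdist[of P Self fst "\<lambda>_. p"] fst p(1)
    by (simp add: Xd mtopology_of_def)
  then have "continuous_map P euclideanreal (\<lambda>z. d (fst z) p * snd z)"
    using snd by (rule continuous_map_real_mult)
  then have "closedin P {z \<in> topspace P. d (fst z) p * snd z \<in> {1}}"
    by (rule closedin_continuous_map_preimage) simp
  moreover have "closedin P {(p, 0)}"
    using Polish_space_Hausdorff[OF pol] p by (simp add: closedin_Hausdorff_singleton topP)
  ultimately have clG: "closedin P G" unfolding G_def by blast
  have topG: "topspace (subtopology P G) = G"
    using clG closedin_subset by fastforce
  have lift: "(x, inverse (d x p)) \<in> G" if "x \<in> M" "x \<noteq> p" for x
    using that p by (simp add: G_def topP)
  have "bij_betw fst G M"
    unfolding bij_betw_def
  proof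
    show "inj_on fst G"
      by (auto simp: inj_on_def G_def topP) (metis inverse_unique mult.commute)
    show "fst ` G = M"
    proof
      show "fst ` G \<subseteq> M" using p by (auto simp: G_def topP)
      show "M \<subseteq> fst ` G"
      proof
        fix x assume "x \<in> M"
        then show "x \<in> fst ` G"
          using lift[of x] by (cases "x = p") (force simp: G_def)+
      qed
    qed
  qed
  then have "bij_betw (f \<circ> fst) (topspace (subtopology P G)) (topspace Y)"
    using f(2) unfolding topG top by (rule bij_betw_trans)
  moreover have "continuous_map (subtopology P G) Y (f \<circ> fst)"
    using fst f(1) by (intro continuous_map_compose[of _ X]) (auto intro: continuous_map_from_subtopology)
  \<comment> \<open>On a compact \<open>G\<close> the second coordinate would be bounded, but points
    close to \<open>p\<close> are lifted arbitrarily high.\<close>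
  moreover have "\<not> compact_space (subtopology P G)"
  proof
    assume "compact_space (subtopology P G)"
    then have "compactin P G"
      using topG by (metis compactin_subtopology compact_space_def)
    then have "compact (snd ` G)"
      using snd image_compactin compactin_euclidean_iff by blast
    then obtain B where B: "\<And>z. z \<in> G \<Longrightarrow> \<bar>snd z\<bar> \<le> B"
      by (metis compact_imp_bounded bounded_iff image_eqI real_norm_def)
    have B0: "B \<ge> 0" using B[of "(p,0)"] by (simp add: G_def)
    \<comment> \<open>The radius is chosen so that the lift of \<open>x\<close> has height above
      \<open>B + 1\<close>; adding 1 avoids inverting 0, as \<open>B\<close> may be 0.\<close>
    have "p \<in> mball p (inverse (B + 1))" using p B0 by simp
    then obtain x where x: "x \<noteq> p" "x \<in> M" "x \<in> mball p (inverse (B + 1))"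
      using p(2) openin_mball unfolding in_derived_set_of by blast
    have "0 < d x p" "d x p < inverse (B + 1)"
      using x p by (auto simp: commute)
    then have "B + 1 < inverse (d x p)"
      using B0 by (metis inverse_inverse_eq less_imp_inverse_less)
    then show False using B[OF lift[OF x(2,1)]] by simp
  qed
  ultimately show ?thesis
    using c_Lusin_spaceI[OF Y _ locally_compact_space_closed_subset[OF lc clG]
        Polish_space_closedin[OF pol clG]] by blast
qed

section \<open>Infinite discrete sets and nowhere dense closures\<close>

text \<open>If \<open>A\<close> contains none of its accumulation points, \<open>A\<close> itself is
  discrete. Otherwise some \<open>p\<close> in \<open>A\<close> is an accumulation point, and points
  of \<open>A\<close> are chosen one after another inside decreasing neighbourhoods of
  \<open>p\<close>, each with a neighbourhood of its own that all later points avoid.\<close>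

lemma Hausdorff_infinite_discrete_subset:
  assumes Y: "Hausdorff_space Y" and A: "A \<subseteq> topspace Y" "infinite A"
  obtains E where "E \<subseteq> A" "infinite E" "\<And>e. e \<in> E \<Longrightarrow> \<exists>G. openin Y G \<and> G \<inter> E = {e}"
proof (cases "A \<inter> Y derived_set_of A = {}")
  case True
  have "\<exists>G. openin Y G \<and> G \<inter> A = {e}" if "e \<in> A" for e
  proof -
    have "e \<notin> Y derived_set_of A" "e \<in> topspace Y" using that True A by auto
    then obtain G where "openin Y G" "e \<in> G" "\<forall>y. y \<noteq> e \<longrightarrow> y \<in> A \<longrightarrow> y \<notin> G"
      unfolding in_derived_set_of by blast
    then show ?thesis using that by (intro exI[of _ G]) blast
  qed
  then show ?thesis using A that by blast
next
  case False
  then obtain p where p: "p \<in> A" "p \<in> Y derived_set_of A" by blast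
  \<comment> \<open>\<open>x\<close> is the chosen point, \<open>U\<close> isolates it, and
    \<open>V\<close> is the neighbourhood of \<open>p\<close> in which all later choices are
    made.\<close>
  define Q where "Q = (\<lambda>(x, U, V). x \<in> A \<and> openin Y U \<and> openin Y V \<and> x \<in> U \<and> p \<in> V \<and> U \<inter> V = {})"
  have pick: "\<exists>x U V. Q (x, U, V) \<and> U \<subseteq> W \<and> V \<subseteq> W" if W: "openin Y W" "p \<in> W" for W
  proof -
    obtain x where x: "x \<noteq> p" "x \<in> A" "x \<in> W"
      using W p(2) unfolding in_derived_set_of by blast
    have "x \<in> topspace Y" "p \<in> topspace Y" using x p(1) A(1) by auto
    then obtain U V where "openin Y U" "openin Y V" "x \<in> U" "p \<in> V" "disjnt U V"
      using Y x(1) unfolding Hausdorff_space_def by metis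
    then have "Q (x, U \<inter> W, V \<inter> W)"
      using W x by (auto simp: Q_def disjnt_def)
    then show ?thesis by blast
  qed
  \<comment> \<open>Placing the next \<open>U\<close> and \<open>V\<close> inside the previous
    \<open>V\<close> makes the sets \<open>U n\<close> pairwise disjoint.\<close>
  have "\<exists>s. \<forall>n. Q (s n) \<and> fst (snd (s (Suc n))) \<subseteq> snd (snd (s n)) \<and>
      snd (snd (s (Suc n))) \<subseteq> snd (snd (s n))"
  proof (rule dependent_nat_choice)
    show "\<exists>t. Q t" using pick[of "topspace Y"] p A by blast
    fix t :: "'a \<times> 'a set \<times> 'a set" and n :: nat assume t: "Q t"
    have "openin Y (snd (snd t))" "p \<in> snd (snd t)"
      using t by (auto simp: Q_def split: prod.splits)
    from pick[OF this] show "\<exists>t'. Q t' \<and> fst (snd t') \<subseteq> snd (snd t) \<and> snd (snd t') \<subseteq> snd (snd t)"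
      by force
  qed
  then obtain s where s: "\<And>n. Q (s n)"
    "\<And>n. fst (snd (s (Suc n))) \<subseteq> snd (snd (s n))" "\<And>n. snd (snd (s (Suc n))) \<subseteq> snd (snd (s n))"
    by blast
  define x U V where "x n = fst (s n)" and "U n = fst (snd (s n))" and "V n = snd (snd (s n))" for n
  have Q: "x n \<in> A" "openin Y (U n)" "x n \<in> U n" "U n \<inter> V n = {}" for n
    using s(1)[of n] by (auto simp: Q_def x_def U_def V_def split: prod.splits)
  have mono: "V n \<subseteq> V m" if "m \<le> n" for m n
  proof -
    have "V (Suc k) \<subseteq> V k" for k using s(3) by (simp add: V_def)
    then show ?thesis using that by (rule lift_Suc_antimono_le)
  qed
  have UV: "U n \<subseteq> V m" if mn: "m < n" for m n
  proof -
    obtain k where "n = Suc k" "m \<le> k" using mn by (cases n) auto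
    then show ?thesis using s(2)[of k] mono[of m k] by (auto simp: U_def V_def)
  qed
  have disj: "U m \<inter> U n = {}" if "m \<noteq> n" for m n
    using that UV[of m n] UV[of n m] Q(4)[of m] Q(4)[of n] by (cases m n rule: linorder_cases) blast+
  have sep: "x n \<in> U m \<longleftrightarrow> n = m" for m n
    using disj[of m n] Q(3)[of n] by blast
  have "inj x"
    by (rule injI) (metis sep)
  then have "infinite (range x)" by (simp add: range_inj_infinite)
  moreover have "U n \<inter> range x = {x n}" for n using sep by auto
  ultimately show ?thesis
    using that[of "range x"] Q by blast
qed

lemma nowhere_dense_in_closedin:
  "closedin X S \<Longrightarrow> nowhere_dense_in X S \<longleftrightarrow> X interior_of S = {}"
  by (simp add: nowhere_dense_in_def closedin_subset closure_of_closedin)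

text \<open>A nonempty interior would meet \<open>E\<close> in some \<open>e\<close>, isolated in
  \<open>E\<close> by an open \<open>G\<close>. As \<open>{e}\<close> is closed, the closure of
  \<open>E\<close> has no further point in \<open>G\<close>, so \<open>{e}\<close> would be open,
  although \<open>e\<close> is an accumulation point of \<open>Y\<close>.\<close>

lemma interior_closure_of_discrete_empty:
  assumes Y: "t1_space Y" and E: "E \<subseteq> Y derived_set_of (topspace Y)"
    and disc: "\<And>e. e \<in> E \<Longrightarrow> \<exists>G. openin Y G \<and> G \<inter> E = {e}"
  shows "Y interior_of (Y closure_of E) = {}"
proof (rule ccontr)
  let ?V = "Y interior_of (Y closure_of E)"
  assume "?V \<noteq> {}"
  moreover have sub: "?V \<subseteq> Y closure_of E" by (rule interior_of_subset)
  ultimately have "?V \<inter> E \<noteq> {}"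
    using openin_Int_closure_of_eq_empty[OF openin_interior_of, of Y "Y closure_of E" E]
    by (simp add: Int_absorb2)
  then obtain e where e: "e \<in> ?V" "e \<in> E" by blast
  then obtain G where G: "openin Y G" "G \<inter> E = {e}" using disc by blast
  have eY: "e \<in> topspace Y" using e(2) E by (meson derived_set_of_subset_topspace subsetD)
  have "G \<inter> ?V \<subseteq> G \<inter> Y closure_of E" using sub by (rule Int_mono[OF order_refl])
  also have "\<dots> \<subseteq> Y closure_of (G \<inter> E)" using G(1) by (rule openin_Int_closure_of_subset)
  also have "\<dots> = {e}"
  proof -
    have "closedin Y {e}" using Y eY unfolding t1_space_closedin_singleton by blast
    then show ?thesis unfolding G(2) by (rule closure_of_closedin)
  qed
  finally have "G \<inter> ?V \<subseteq> {e}" .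
  moreover have "openin Y (G \<inter> ?V)" "e \<in> G \<inter> ?V"
    using G e by auto
  moreover have "e \<in> Y derived_set_of (topspace Y)" using e E by blast
  ultimately show False unfolding in_derived_set_of by blast
qed

section \<open>Baire spaces and feebly open maps\<close>

lemma Baire_space_completely_metrizable:
  "completely_metrizable_space X \<Longrightarrow> Baire_space X"
  unfolding Baire_space_def using Baire_category_alt by blast

text \<open>Relatively open subsets of the open set \<open>Z\<close> are open in \<open>Y\<close>,
  so traces on \<open>Z\<close> keep empty interiors. The interior of the union therefore misses
  \<open>Z\<close> and lies in its complement, which has empty interior.\<close>

lemma Baire_space_dense_open:
  assumes Z: "openin Y Z" "Baire_space (subtopology Y Z)"
    and dense: "nowhere_dense_in Y (topspace Y - Z)"
  shows "Baire_space Y"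
  unfolding Baire_space_def
proof (intro allI impI)
  fix \<C> assume C: "countable \<C> \<and> (\<forall>C\<in>\<C>. closedin Y C \<and> Y interior_of C = {})"
  let ?U = "Y interior_of \<Union>\<C>"
  have ZU: "openin (subtopology Y Z) V \<longleftrightarrow> openin Y V \<and> V \<subseteq> Z" for V
    using Z(1) by (simp add: openin_open_subtopology)
  have empty: "subtopology Y Z interior_of (Z \<inter> C) = {}" if "C \<in> \<C>" for C
  proof -
    have "Y interior_of C = {}" using C that by blast
    then show ?thesis unfolding interior_of_eq_empty ZU by blast
  qed
  have "subtopology Y Z interior_of \<Union>((\<lambda>C. Z \<inter> C) ` \<C>) = {}"
  proof -
    have "closedin (subtopology Y Z) (Z \<inter> C)" if "C \<in> \<C>" for C
      using C that by (simp add: closedin_subtopology_Int_closed)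
    then show ?thesis
      using C empty by (intro Z(2)[unfolded Baire_space_def, rule_format]) auto
  qed
  moreover have "openin Y (Z \<inter> ?U)" "Z \<inter> ?U \<subseteq> \<Union>((\<lambda>C. Z \<inter> C) ` \<C>)"
    using Z(1) interior_of_subset[of Y "\<Union>\<C>"] by auto
  ultimately have "Z \<inter> ?U = {}"
    unfolding interior_of_eq_empty ZU by blast
  then have "?U \<subseteq> topspace Y - Z"
    using interior_of_subset_topspace[of Y "\<Union>\<C>"] by blast
  moreover have "closedin Y (topspace Y - Z)" using Z(1) by blast
  then have "Y interior_of (topspace Y - Z) = {}"
    using dense nowhere_dense_in_closedin by blast
  ultimately show "?U = {}"
    using openin_interior_of by (metis interior_of_eq_empty)
qed

text \<open>Feeble openness turns a nonempty interior of the preimage of \<open>C\<close> into a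
  nonempty open subset of \<open>C\<close>. So preimages of closed sets with empty interior have
  empty interior too, and the Baire property of \<open>X\<close> applies to them.\<close>

lemma Baire_space_feebly_open:
  assumes X: "Baire_space X" and f: "continuous_map X Y f" "f ` topspace X = topspace Y"
    and feeble: "feebly_open_map X Y f"
  shows "Baire_space Y"
  unfolding Baire_space_def
proof (intro allI impI)
  fix \<C> assume C: "countable \<C> \<and> (\<forall>C\<in>\<C>. closedin Y C \<and> Y interior_of C = {})"
  define pre where "pre S = {x \<in> topspace X. f x \<in> S}" for S
  have "X interior_of (pre C) = {}" if "C \<in> \<C>" for C
  proof (rule ccontr)
    assume "X interior_of (pre C) \<noteq> {}"
    then obtain B where "openin Y B" "B \<noteq> {}" "B \<subseteq> f ` (X interior_of (pre C))"
      using feeble unfolding feebly_open_map_def by (metis openin_interior_of)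
    moreover have "f ` (X interior_of (pre C)) \<subseteq> C"
      using interior_of_subset[of X "pre C"] by (auto simp: pre_def)
    ultimately show False using C that by (metis interior_of_eq_empty subset_trans)
  qed
  moreover have "closedin X (pre C)" if "C \<in> \<C>" for C
    using C that f(1) unfolding pre_def by (simp add: closedin_continuous_map_preimage)
  ultimately have int: "X interior_of \<Union>(pre ` \<C>) = {}"
    using C by (intro X[unfolded Baire_space_def, rule_format]) auto
  let ?U = "Y interior_of \<Union>\<C>"
  have "openin X (pre ?U)"
    using f(1) unfolding pre_def by (simp add: openin_continuous_map_preimage)
  moreover have "pre ?U \<subseteq> \<Union>(pre ` \<C>)"
    using interior_of_subset[of Y "\<Union>\<C>"] by (auto simp: pre_def)
  ultimately have "pre ?U = {}" using int by (metis interior_of_eq_empty)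
  then show "?U = {}"
    using interior_of_subset_topspace[of Y "\<Union>\<C>"] unfolding pre_def f(2)[symmetric] by blast
qed

text \<open>The same transfer for a single closed set; it carries the remainder in \<open>Y\<close>
  back to \<open>X\<close>.\<close>

lemma nowhere_dense_in_feebly_open_preimage:
  assumes f: "continuous_map X Y f" "feebly_open_map X Y f"
    and S: "closedin Y S" "nowhere_dense_in Y S"
  shows "nowhere_dense_in X {x \<in> topspace X. f x \<in> S}" (is "nowhere_dense_in X ?P")
proof -
  have "X interior_of ?P = {}"
  proof (rule ccontr)
    assume "X interior_of ?P \<noteq> {}"
    then obtain B where "openin Y B" "B \<noteq> {}" "B \<subseteq> f ` (X interior_of ?P)"
      using f(2) unfolding feebly_open_map_def by (metis openin_interior_of)
    moreover have "f ` (X interior_of ?P) \<subseteq> S"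
      using interior_of_subset[of X ?P] by auto
    ultimately show False
      using S nowhere_dense_in_closedin[OF S(1)] interior_of_eq_empty[of Y S] by blast
  qed
  then show ?thesis
    using nowhere_dense_in_closedin closedin_continuous_map_preimage[OF f(1) S(1)] by blast
qed

section \<open>The open set over which the bijection is a homeomorphism\<close>

text \<open>By the Lindelof property, countably many of the open sets contained in compact sets
  already cover \<open>X\<close>. Countability lets the Baire property act on the images of these
  compact sets.\<close>

lemma locally_compact_second_countable_sigma_compact:
  assumes "locally_compact_space X" "second_countable X"
  obtains \<K> where "countable \<K>" "\<And>K. K \<in> \<K> \<Longrightarrow> compactin X K" "\<Union>\<K> = topspace X"
proof -
  let ?U = "{U. openin X U \<and> (\<exists>K. compactin X K \<and> U \<subseteq> K)}"
  have "topspace X \<subseteq> \<Union>?U"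
    using assms(1) unfolding locally_compact_space_def by blast
  then have "\<Union>?U = topspace X"
    using openin_subset by blast
  then obtain \<V> where V: "countable \<V>" "\<V> \<subseteq> ?U" "\<Union>\<V> = topspace X"
    using second_countable_imp_Lindelof_space[OF assms(2), unfolded Lindelof_space_def, rule_format, of ?U]
    by auto
  have "\<forall>U\<in>\<V>. \<exists>K. compactin X K \<and> U \<subseteq> K" using V(2) by blast
  then obtain k where k: "\<And>U. U \<in> \<V> \<Longrightarrow> compactin X (k U) \<and> U \<subseteq> k U"
    unfolding bchoice_iff by blast
  show ?thesis
  proof (rule that[of "k ` \<V>"])
    show "countable (k ` \<V>)" "\<And>K. K \<in> k ` \<V> \<Longrightarrow> compactin X K" using V k by auto
    show "\<Union>(k ` \<V>) = topspace X"
      using V(3) k compactin_subset_topspace by fastforce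
  qed
qed

text \<open>For a continuous bijection \<open>f\<close> from a locally compact \<open>X\<close> onto
  a Hausdorff \<open>Y\<close>, this is the largest open subset of \<open>Y\<close> over which
  \<open>f\<close> is a homeomorphism.\<close>

definition compact_image_interior :: "'a topology \<Rightarrow> 'b topology \<Rightarrow> ('a \<Rightarrow> 'b) \<Rightarrow> 'b set" where
  "compact_image_interior X Y f = \<Union>{Y interior_of (f ` K) | K. compactin X K}"

lemma openin_compact_image_interior: "openin Y (compact_image_interior X Y f)"
  unfolding compact_image_interior_def by (rule openin_Union) auto

text \<open>Formulated for arbitrary open subsets \<open>Z\<close> because the final
  \<open>Z\<close> may be smaller: a closed set with empty interior is removed as well.\<close>

lemma homeomorphic_map_compact_image_interior:
  assumes Y: "Hausdorff_space Y"
    and f: "continuous_map X Y f" "bij_betw f (topspace X) (topspace Y)"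
    and Z: "openin Y Z" "Z \<subseteq> compact_image_interior X Y f"
  shows "homeomorphic_map (subtopology X {x \<in> topspace X. f x \<in> Z}) (subtopology Y Z) f"
proof -
  let ?W = "{x \<in> topspace X. f x \<in> Z}"
  have inj: "inj_on f (topspace X)" and surj: "f ` topspace X = topspace Y"
    using f(2) by (auto simp: bij_betw_def)
  have W: "openin X ?W"
    using f(1) Z(1) by (rule openin_continuous_map_preimage)
  have opn: "openin Y (f ` A)" if A: "openin X A" "A \<subseteq> ?W" for A
  proof (subst openin_subopen, intro ballI)
    fix y assume "y \<in> f ` A"
    then obtain x where x: "x \<in> A" "y = f x" by blast
    then have "y \<in> compact_image_interior X Y f" using A(2) Z(2) by blast
    then obtain K where K: "compactin X K" "y \<in> Y interior_of (f ` K)"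
      unfolding compact_image_interior_def by blast
    have "compactin X (K - A)"
    proof -
      have "closedin X (topspace X - A)" using A(1) by blast
      moreover have "K - A = (topspace X - A) \<inter> K"
        using compactin_subset_topspace[OF K(1)] by blast
      ultimately show ?thesis using K(1) by (simp add: closed_Int_compactin)
    qed
    then have "closedin Y (f ` (K - A))"
      using Y f(1) by (meson compactin_imp_closedin image_compactin)
    \<comment> \<open>This is the required neighbourhood of \<open>y\<close>: injectivity keeps
      \<open>y\<close> out of the image of \<open>K - A\<close>, and what is left of
      \<open>f\<close> K\<open>lies in\<close>f \<open>A\<close>.\<close>
    then have "openin Y (Y interior_of (f ` K) - f ` (K - A))"
      by (simp add: openin_diff)
    moreover have "y \<notin> f ` (K - A)"
      using x inj openin_subset[OF A(1)] compactin_subset_topspace[OF K(1)]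
      by (auto dest: inj_onD)
    moreover have "Y interior_of (f ` K) - f ` (K - A) \<subseteq> f ` A"
      using interior_of_subset[of Y "f ` K"] by blast
    ultimately show "\<exists>T. openin Y T \<and> y \<in> T \<and> T \<subseteq> f ` A"
      using K(2) by blast
  qed
  have topW: "topspace (subtopology X ?W) = ?W" and topZ: "topspace (subtopology Y Z) = Z"
    using openin_subset[OF Z(1)] by auto
  show ?thesis
  proof (rule bijective_open_imp_homeomorphic_map)
    show "continuous_map (subtopology X ?W) (subtopology Y Z) f"
      using f(1) by (auto simp: continuous_map_in_subtopology continuous_map_from_subtopology)
    show "open_map (subtopology X ?W) (subtopology Y Z) f"
      unfolding open_map_def using opn
      by (auto simp: openin_open_subtopology[OF W] openin_open_subtopology[OF Z(1)])
    show "f ` topspace (subtopology X ?W) = topspace (subtopology Y Z)"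
    proof -
      have "Z \<subseteq> f ` topspace X" using surj openin_subset[OF Z(1)] by simp
      then show ?thesis unfolding topW topZ by auto
    qed
    show "inj_on f (topspace (subtopology X ?W))"
      unfolding topW by (rule inj_on_subset[OF inj]) auto
  qed
qed

lemma Baire_space_imp_nowhere_dense_remainder:
  assumes Y: "Hausdorff_space Y" "Baire_space Y"
    and X: "locally_compact_space X" "Polish_space X"
    and f: "continuous_map X Y f" "f ` topspace X = topspace Y"
  shows "nowhere_dense_in Y (topspace Y - compact_image_interior X Y f)"
proof -
  let ?R = "topspace Y - compact_image_interior X Y f"
  have R: "closedin Y ?R" using openin_compact_image_interior by blast
  obtain \<K> where K: "countable \<K>" "\<And>K. K \<in> \<K> \<Longrightarrow> compactin X K" "\<Union>\<K> = topspace X"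
    using X locally_compact_second_countable_sigma_compact Polish_space_second_countable by metis
  let ?C = "(\<lambda>K. f ` K \<inter> ?R) ` \<K>"
  have "closedin Y (f ` K \<inter> ?R)" if "K \<in> \<K>" for K
    using Y(1) K(2)[OF that] f(1) R by (meson closedin_Int compactin_imp_closedin image_compactin)
  \<comment> \<open>The interior of the image of \<open>K\<close> lies in
    \<open>compact_image_interior X Y f\<close>, which is disjoint from \<open>?R\<close>.\<close>
  moreover have "Y interior_of (f ` K \<inter> ?R) = {}" if "K \<in> \<K>" for K
  proof -
    have "Y interior_of (f ` K) \<subseteq> compact_image_interior X Y f"
      using K(2)[OF that] unfolding compact_image_interior_def by blast
    then show ?thesis
      using interior_of_subset[of Y ?R] by (auto simp: interior_of_Int)
  qed
  ultimately have "Y interior_of \<Union>?C = {}"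
    using K(1) by (intro Y(2)[unfolded Baire_space_def, rule_format]) auto
  moreover have "\<Union>?C = f ` \<Union>\<K> \<inter> ?R" by blast
  then have "\<Union>?C = ?R" unfolding K(3) f(2) by blast
  ultimately show ?thesis using nowhere_dense_in_closedin[OF R] by simp
qed

section \<open>The decomposition of a c-Lusin space\<close>

text \<open>The finite alternative accounts for spaces such as the one in
  \<open>discrete_nat_no_c_Lusin_remainder\<close>, where a nowhere dense remainder cannot be
  c-Lusin. It is excluded as soon as \<open>Y\<close> has infinitely many accumulation
  points.\<close>

theorem theorem2p4:
  fixes X :: "'a topology" and Y :: "'b topology" and f :: "'a \<Rightarrow> 'b"
  assumes "\<not> compact_space X" and "locally_compact_space X" and "Polish_space X"
    and "Hausdorff_space Y"
    and "continuous_map X Y f" and "bij_betw f (topspace X) (topspace Y)"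
  shows "\<exists>Z. openin Y Z \<and>
    (let Y1 = topspace Y - Z; X1 = {x \<in> topspace X. f x \<in> Y1} in
       (locally_compact_space (subtopology Y Z) \<and> Polish_space (subtopology Y Z)) \<and>
       (c_Lusin_space (subtopology Y Y1) \<or>
          (finite Y1 \<and> finite (Y derived_set_of (topspace Y)))) \<and>
       (nowhere_dense_in Y Y1 \<longleftrightarrow> Baire_space Y) \<and>
       (feebly_open_map X Y f \<longrightarrow> Baire_space Y \<and> nowhere_dense_in X X1))"
proof -
  have inj: "inj_on f (topspace X)" and surj: "f ` topspace X = topspace Y"
    using assms(6) by (auto simp: bij_betw_def)
  define Z0 where "Z0 = compact_image_interior X Y f"
  have Z0: "openin Y Z0" unfolding Z0_def by (rule openin_compact_image_interior)
  \<comment> \<open>\<open>D\<close> makes the remainder infinite when \<open>Y\<close> has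
    infinitely many accumulation points. Being closed, it leaves \<open>Z\<close> open; having empty
    interior, it leaves the remainder nowhere dense when \<open>Y\<close> is Baire.\<close>
  obtain D where D: "closedin Y D" "Y interior_of D = {}"
    "infinite D \<or> finite (Y derived_set_of (topspace Y))"
  proof (cases "finite (Y derived_set_of (topspace Y))")
    case True
    then show ?thesis using that[of "{}"] by simp
  next
    case False
    then obtain E where E: "E \<subseteq> Y derived_set_of (topspace Y)" "infinite E"
      "\<And>e. e \<in> E \<Longrightarrow> \<exists>G. openin Y G \<and> G \<inter> E = {e}"
      using Hausdorff_infinite_discrete_subset[OF assms(4) derived_set_of_subset_topspace] by metis
    have "E \<subseteq> Y closure_of E"
      using E(1) derived_set_of_subset_topspace by (rule closure_of_subset[OF order_trans])
    then have "infinite (Y closure_of E)" using E(2) finite_subset by blast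
    moreover have "Y interior_of (Y closure_of E) = {}"
      using Hausdorff_imp_t1_space[OF assms(4)] E(1,3) by (rule interior_closure_of_discrete_empty)
    ultimately show ?thesis using that[of "Y closure_of E"] by simp
  qed
  define Z where "Z = Z0 - D"
  have Z: "openin Y Z" "Z \<subseteq> compact_image_interior X Y f"
    using Z0 D(1) by (auto simp: Z_def Z0_def openin_diff)
  define Y1 where "Y1 = topspace Y - Z"
  define X1 where "X1 = {x \<in> topspace X. f x \<in> Y1}"
  have clY1: "closedin Y Y1" using Z(1) by (auto simp: Y1_def)
  have clX1: "closedin X X1"
    unfolding X1_def using assms(5) clY1 by (rule closedin_continuous_map_preimage)
  have Y1_split: "Y1 = D \<union> (topspace Y - Z0)"
    using closedin_subset[OF D(1)] by (auto simp: Y1_def Z_def)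

  have W: "openin X {x \<in> topspace X. f x \<in> Z}"
    using assms(5) Z(1) by (rule openin_continuous_map_preimage)
  have hom: "subtopology X {x \<in> topspace X. f x \<in> Z} homeomorphic_space subtopology Y Z"
    using homeomorphic_map_compact_image_interior[OF assms(4-6) Z]
    by (rule homeomorphic_map_imp_homeomorphic_space)
  have lcZ: "locally_compact_space (subtopology Y Z)"
    using homeomorphic_locally_compact_space[OF hom]
      locally_compact_space_open_subset[OF _ assms(2) W] Polish_space_Hausdorff[OF assms(3)] by blast
  have polZ: "Polish_space (subtopology Y Z)"
    using Polish_space_openin[OF assms(3) W] homeomorphic_separable_space[OF hom]
      homeomorphic_completely_metrizable_space[OF hom] unfolding Polish_space_def by blast

  \<comment> \<open>\<open>X1\<close> is closed in \<open>X\<close> and so locally compact and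
    Polish, but it may be compact. Hence the appeal to \<open>c_Lusin_spaceI_infinite\<close>, for
    which infinitude suffices.\<close>
  have lusin: "c_Lusin_space (subtopology Y Y1)" if "infinite Y1"
  proof -
    have img: "f ` X1 = Y1"
      using surj closedin_subset[OF clY1] by (auto simp: X1_def)
    have top: "topspace (subtopology X X1) = X1" "topspace (subtopology Y Y1) = Y1"
      using closedin_subset[OF clX1] closedin_subset[OF clY1] by auto
    show ?thesis
    proof (rule c_Lusin_spaceI_infinite[of _ "subtopology X X1" f])
      show "Hausdorff_space (subtopology Y Y1)"
        by (simp add: assms(4) Hausdorff_space_subtopology)
      show "infinite (topspace (subtopology X X1))"
        unfolding top using that img by (metis finite_imageI)
      show "locally_compact_space (subtopology X X1)"
        by (rule locally_compact_space_closed_subset[OF assms(2) clX1])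
      show "Polish_space (subtopology X X1)"
        by (rule Polish_space_closedin[OF assms(3) clX1])
      show "continuous_map (subtopology X X1) (subtopology Y Y1) f"
        using assms(5) by (auto simp: continuous_map_in_subtopology continuous_map_from_subtopology X1_def)
      show "bij_betw f (topspace (subtopology X X1)) (topspace (subtopology Y Y1))"
        unfolding top bij_betw_def using img inj_on_subset[OF inj closedin_subset[OF clX1]] by simp
    qed
  qed
  \<comment> \<open>If \<open>Y1\<close> is finite, so is its subset \<open>D\<close>, and then the
    choice of \<open>D\<close> leaves only finitely many accumulation points.\<close>
  have b: "c_Lusin_space (subtopology Y Y1) \<or> (finite Y1 \<and> finite (Y derived_set_of (topspace Y)))"
    using lusin D(3) Y1_split by auto

  have baire: "nowhere_dense_in Y Y1 \<longleftrightarrow> Baire_space Y"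
  proof
    assume "nowhere_dense_in Y Y1"
    \<comment> \<open>\<open>Z\<close> is Polish, hence Baire, and its complement is nowhere dense
      by assumption.\<close>
    then show "Baire_space Y"
      using Baire_space_dense_open[OF Z(1)] Baire_space_completely_metrizable polZ
      unfolding Y1_def Polish_space_def by blast
  next
    assume "Baire_space Y"
    then have "nowhere_dense_in Y (topspace Y - Z0)"
      using Baire_space_imp_nowhere_dense_remainder[OF assms(4) _ assms(2,3,5) surj]
      unfolding Z0_def by blast
    then have "Y interior_of (topspace Y - Z0) = {}"
      using nowhere_dense_in_closedin[of Y "topspace Y - Z0"] Z0 by blast
    then have "Y interior_of Y1 = {}"
      unfolding Y1_split using D(1,2) by (simp add: interior_of_union_eq_empty)
    then show "nowhere_dense_in Y Y1" by (simp add: nowhere_dense_in_closedin clY1)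
  qed

  \<comment> \<open>The Baire property passes from \<open>X\<close> to \<open>Y\<close>; the
    equivalence just shown makes \<open>Y1\<close> nowhere dense, and feeble openness transfers this
    to \<open>X1\<close>.\<close>
  have "Baire_space Y \<and> nowhere_dense_in X X1" if "feebly_open_map X Y f"
  proof -
    have "Baire_space X"
      using Baire_space_completely_metrizable[of X] assms(3) by (simp add: Polish_space_def)
    then have "Baire_space Y"
      using assms(5) surj that by (rule Baire_space_feebly_open)
    then show ?thesis
      using nowhere_dense_in_feebly_open_preimage[OF assms(5) that clY1] baire
      unfolding X1_def by blast
  qed
  then show ?thesis
    using Z(1) lcZ polZ b baire unfolding Let_def Y1_def X1_def by blast
qed

end
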